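(* Let $m \ge n$ be positive integers. Any $A \in \mathbf{R}^{m \times n}$ can be factored as $$A = G \begin{pmatrix} 0 \\ B \end{pmatrix},$$ where $B \in \mathbf{R}^{n \times n}$ is square (and $0$ is the $(m-n)\times n$ zero block) and $G \in \mathbf{R}^{m\times m}$ is a banded product of $m-n$ Householder reflections with $n+1$ band components per vector, the first of which is $1$; that is, $$G = H_1 H_2 \cdots H_{m-n}, \qquad H_i = I - \frac{2 v_i v_i^T}{v_i^T v_i},$$ $$v_i = \bigl(\underbrace{0, 0, \ldots, 0}_{i-1},\, 1,\, \underbrace{v_{i,i+1}, \ldots, v_{i,i+n}}_{n},\, \underbrace{0, 0, \ldots, 0}_{m-n-i}\bigr)^T \in \mathbf{R}^m, \qquad i = 1, \ldots, m-n.$$ In particular, $G$ is specified by the $n(m-n)$ real numbers $v_{i,j}$ ($1 \le i \le m-n$, $i+1 \le j \le i+n$).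
   Context: $I$ denotes the $m \times m$ identity matrix. The entries $v_{i,i+1}, \ldots, v_{i,i+n}$ are arbitrary real numbers (possibly zero); the paper refers to the $n+1$ band positions $i, \ldots, i+n$ of $v_i$ as its "nonzero components". When $m=n$ the product defining $G$ is empty and equals $I$. The paper measures storage in floats (floating point numbers), one float per real parameter: "$G$ can be stored in $n(m-n)$ floats" means that $G$ is specified by the $n(m-n)$ real numbers $v_{i,j}$. *)

theory Defs
  imports Complex_Main "Jordan_Normal_Form.Matrix"
begin

text \<open>The reflection $I - 2 v v^T / (v^T v)$. For the zero vector, division by zero makes
  this the identity; the vectors used below have an entry 1 and hence are nonzero.\<close>

definition householder :: "real vec \<Rightarrow> real mat" where
  "householder v =
     1\<^sub>m (dim_vec v) - (2 / (v \<bullet> v)) \<cdot>\<^sub>m (transpose_mat (mat_of_row v) * mat_of_row v)"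

text \<open>The parameters \<open>v i j\<close> are indexed from 1 in both arguments, whereas vector positions
  start at 0: position \<open>k\<close> holds the \<open>Suc k\<close>-th component. For \<open>1 \<le> i \<le> m - n\<close> the
  band \<open>i, \<dots>, i + n\<close> lies inside \<open>1, \<dots>, m\<close>.\<close>

definition band_vec :: "nat \<Rightarrow> nat \<Rightarrow> (nat \<Rightarrow> nat \<Rightarrow> real) \<Rightarrow> nat \<Rightarrow> real vec" where
  "band_vec m n v i = vec m (\<lambda>k.
     if Suc k = i then 1
     else if i + 1 \<le> Suc k \<and> Suc k \<le> i + n then v i (Suc k)
     else 0)"

text \<open>The product $H_1 H_2 \cdots H_{m-n}$, in this order; it is the identity if \<open>m = n\<close>.\<close>

definition banded_householder :: "nat \<Rightarrow> nat \<Rightarrow> (nat \<Rightarrow> nat \<Rightarrow> real) \<Rightarrow> real mat" where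
  "banded_householder m n v =
     foldr (\<lambda>i M. householder (band_vec m n v i) * M) [1..<Suc (m - n)] (1\<^sub>m m)"

definition band_params :: "nat \<Rightarrow> nat \<Rightarrow> (nat \<times> nat) set" where
  "band_params m n = {(i, j). 1 \<le> i \<and> i \<le> m - n \<and> i + 1 \<le> j \<and> j \<le> i + n}"

end

theory Submission
  imports Defs "Jordan_Normal_Form.Determinant"
begin

text \<open>Row \<open>k\<close> of \<open>H C\<close> vanishes iff \<open>H e\<^sub>k\<close> is orthogonal to the columns of \<open>C\<close>. A unit vector \<open>u\<close>
  supported on the band of \<open>n + 1\<close> positions starting at \<open>k\<close> and orthogonal to the \<open>n\<close> columns
  exists because there are more unknowns than equations, and the reflection along \<open>e\<^sub>k - u\<close> maps
  \<open>e\<^sub>k\<close> to \<open>u\<close>. Choosing the sign of \<open>u\<close> so that \<open>u\<^sub>k \<le> 0\<close> makes the leading component \<open>1 - u\<^sub>k\<close>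
  nonzero, so it can be scaled to 1. Rows above \<open>k\<close> are untouched, hence the rows can be
  annihilated one after the other from the top.\<close>

section \<open>Householder reflections acting on vectors and matrices\<close>

lemma householder_carrier [simp]: "v \<in> carrier_vec m \<Longrightarrow> householder v \<in> carrier_mat m m"
  by (auto simp: householder_def mat_of_row_def)

lemma householder_mult_vec:
  assumes v: "v \<in> carrier_vec m" and x: "x \<in> carrier_vec m"
  shows "householder v *\<^sub>v x = x - (2 * (v \<bullet> x) / (v \<bullet> v)) \<cdot>\<^sub>v v"
proof -
  define P where "P = transpose_mat (mat_of_row v) * mat_of_row v"
  have row: "mat_of_row v \<in> carrier_mat 1 m"
    using v by auto
  then have P: "P \<in> carrier_mat m m"
    by (auto simp: P_def)
  have "row (mat_of_row v) 0 = v"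
    by simp
  \<comment> \<open>The outer product acts in two stages: the row yields the scalar
    \<open>v \<bullet> x\<close> as a vector of length 1, and the column then multiplies it by
    \<open>v\<close>.\<close>
  then have "mat_of_row v *\<^sub>v x = vec 1 (\<lambda>_. v \<bullet> x)"
    using v by (intro eq_vecI) auto
  then have "P *\<^sub>v x = transpose_mat (mat_of_row v) *\<^sub>v vec 1 (\<lambda>_. v \<bullet> x)"
    unfolding P_def using row x by (subst assoc_mult_mat_vec[of _ m 1 _ m]) auto
  also have "\<dots> = (v \<bullet> x) \<cdot>\<^sub>v v"
    using v by (intro eq_vecI) (auto simp: scalar_prod_def)
  finally have Px: "P *\<^sub>v x = (v \<bullet> x) \<cdot>\<^sub>v v" .
  have "householder v *\<^sub>v x = 1\<^sub>m m *\<^sub>v x - ((2 / (v \<bullet> v)) \<cdot>\<^sub>m P) *\<^sub>v x"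
    unfolding householder_def P_def[symmetric] using v x P
    by (subst minus_mult_distrib_mat_vec[of _ m m]) auto
  also have "((2 / (v \<bullet> v)) \<cdot>\<^sub>m P) *\<^sub>v x = (2 / (v \<bullet> v)) \<cdot>\<^sub>v (P *\<^sub>v x)"
    using P x by (intro eq_vecI) auto
  finally show ?thesis
    using v x by (simp add: Px smult_smult_assoc)
qed

text \<open>A reflection flips the sign of \<open>v \<bullet> x\<close>, so the second application
  adds back the multiple of \<open>v\<close> that the first one subtracted.\<close>

lemma householder_involution_vec:
  assumes v: "v \<in> carrier_vec m" and x: "x \<in> carrier_vec m"
  shows "householder v *\<^sub>v (householder v *\<^sub>v x) = x"
proof -
  define a where "a = 2 * (v \<bullet> x) / (v \<bullet> v)"
  \<comment> \<open>This covers \<open>v = 0\<close>, where division by zero gives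
    \<open>a = 0\<close>.\<close>
  have "v \<bullet> x = 0" if "v \<bullet> v = 0"
    using that v x by (simp add: scalar_prod_def sum_nonneg_eq_0_iff)
  then have "v \<bullet> (x - a \<cdot>\<^sub>v v) = - (v \<bullet> x)"
    using v x by (subst scalar_prod_minus_distrib[of _ m]) (auto simp: a_def)
  then have "householder v *\<^sub>v (x - a \<cdot>\<^sub>v v) = (x - a \<cdot>\<^sub>v v) - (- a) \<cdot>\<^sub>v v"
    using v x by (subst householder_mult_vec[of _ m]) (auto simp: a_def)
  also have "\<dots> = x"
    using v x by (intro eq_vecI) auto
  finally show ?thesis
    using householder_mult_vec[OF v x] by (simp add: a_def)
qed

lemma householder_involution_mat:
  assumes v: "v \<in> carrier_vec m" and C: "C \<in> carrier_mat m n"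
  shows "householder v * (householder v * C) = C"
proof (rule mat_col_eqI)
  fix j assume "j < dim_col C"
  then have j: "j < n"
    using C by simp
  have H: "householder v \<in> carrier_mat m m"
    using v by simp
  have "col (householder v * (householder v * C)) j = householder v *\<^sub>v (householder v *\<^sub>v col C j)"
    using H C j by (simp add: col_mult2[of _ m m _ n])
  also have "\<dots> = col C j"
    using C by (intro householder_involution_vec[OF v]) auto
  finally show "col (householder v * (householder v * C)) j = col C j" .
qed (use C carrier_matD[OF householder_carrier[OF v]] in auto)

section \<open>Annihilating one row by a banded reflection\<close>

text \<open>The \<open>n + 1\<close> band entries of \<open>u\<close> are subject to
  \<open>n\<close> homogeneous linear equations, so a nonzero solution exists over any
  field.\<close>

lemma ex_band_orthogonal:
  fixes C :: "'a :: field mat"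
  assumes C: "C \<in> carrier_mat m n" and k: "k + n < m"
  obtains u where "u \<in> carrier_vec m" "u \<noteq> 0\<^sub>v m"
    "\<And>l. l < m \<Longrightarrow> l < k \<or> k + n < l \<Longrightarrow> u $ l = 0"
    "\<And>c. c < n \<Longrightarrow> u \<bullet> col C c = 0"
proof -
  define R where "R = (\<lambda>r. vec (Suc n) (\<lambda>c. C $$ (k + c, r)))"
  \<comment> \<open>Row \<open>r < n\<close> is the band section of column \<open>r\<close> of
    \<open>C\<close>. A zero row makes the system square and singular, so that a kernel vector comes
    from the determinant.\<close>
  define M where "M = mat\<^sub>r (Suc n) (Suc n) (\<lambda>r. if r = n then 0\<^sub>v (Suc n) else R r)"
  have M: "M \<in> carrier_mat (Suc n) (Suc n)"
    by (simp add: M_def)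
  have "det M = 0"
    unfolding M_def by (rule det_row_0) (auto simp: R_def)
  then obtain y where y: "y \<in> carrier_vec (Suc n)" "y \<noteq> 0\<^sub>v (Suc n)" "M *\<^sub>v y = 0\<^sub>v (Suc n)"
    using det_0_iff_vec_prod_zero_field[OF M] by blast
  define u where "u = vec m (\<lambda>l. if l < k \<or> k + n < l then 0 else y $ (l - k))"
  have u_y: "u $ (k + c) = y $ c" if "c \<le> n" for c
    using that k by (simp add: u_def)
  show thesis
  proof (rule that[of u])
    obtain c where "c \<le> n" "y $ c \<noteq> 0"
      using y(1,2) by (metis carrier_vecD eq_vecI index_zero_vec(1,2) less_Suc_eq_le)
    then show "u \<noteq> 0\<^sub>v m"
      using u_y[of c] k by auto
  next
    fix c assume c: "c < n"
    have "u \<bullet> col C c = (\<Sum>l = 0..<m. u $ l * C $$ (l, c))"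
      using C c by (simp add: scalar_prod_def)
    also have "\<dots> = (\<Sum>l = k..<k + Suc n. u $ l * C $$ (l, c))"
      using k by (intro sum.mono_neutral_right) (auto simp: u_def)
    also have "\<dots> = (\<Sum>l = 0..<Suc n. u $ (k + l) * C $$ (k + l, c))"
      using sum.shift_bounds_nat_ivl[of "\<lambda>l. u $ l * C $$ (l, c)" 0 k "Suc n"]
      by (simp add: add.commute)
    also have "\<dots> = (\<Sum>l = 0..<Suc n. R c $ l * y $ l)"
      by (intro sum.cong) (auto simp: u_y R_def)
    also have "\<dots> = (M *\<^sub>v y) $ c"
      using c y(1) by (simp add: M_def R_def scalar_prod_def)
    finally show "u \<bullet> col C c = 0"
      using y(3) c by simp
  qed (auto simp: u_def)
qed

lemma ex_band_orthogonal_unit: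
  fixes C :: "real mat"
  assumes C: "C \<in> carrier_mat m n" and k: "k + n < m"
  obtains u where "u \<in> carrier_vec m" "u \<bullet> u = 1" "u $ k \<le> 0"
    "\<And>l. l < m \<Longrightarrow> l < k \<or> k + n < l \<Longrightarrow> u $ l = 0"
    "\<And>c. c < n \<Longrightarrow> u \<bullet> col C c = 0"
proof -
  obtain x where x: "x \<in> carrier_vec m" "x \<noteq> 0\<^sub>v m"
    and supp: "\<And>l. l < m \<Longrightarrow> l < k \<or> k + n < l \<Longrightarrow> x $ l = 0"
    and orth: "\<And>c. c < n \<Longrightarrow> x \<bullet> col C c = 0"
    using ex_band_orthogonal[OF C k] by metis
  have "x \<bullet> x \<noteq> 0"
    using x by (auto simp: scalar_prod_def sum_nonneg_eq_0_iff)
  moreover have "x \<bullet> x \<ge> 0"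
    by (simp add: scalar_prod_def sum_nonneg)
  ultimately have pos: "x \<bullet> x > 0"
    by simp
  \<comment> \<open>The sign forces entry \<open>k\<close> to be nonpositive, the denominator
    normalises the length.\<close>
  define s where "s = (if x $ k \<le> 0 then 1 else -1) / sqrt (x \<bullet> x)"
  have s2: "s * (s * (x \<bullet> x)) = 1"
    using pos by (simp add: s_def field_simps)
  show thesis
  proof (rule that[of "s \<cdot>\<^sub>v x"])
    show "(s \<cdot>\<^sub>v x) $ k \<le> 0"
      using x k pos by (auto simp: s_def divide_simps)
  qed (use x C supp orth s2 k in auto)
qed

text \<open>Since \<open>w\<close> vanishes above position \<open>k\<close>, the reflection keeps
  the zero rows there; in row \<open>k\<close> it subtracts exactly the entry of
  \<open>C\<close>.\<close>

lemma ex_band_householder_step: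
  assumes C: "C \<in> carrier_mat m n" and k: "k + n < m"
    and zero: "\<And>r c. r < k \<Longrightarrow> c < n \<Longrightarrow> C $$ (r, c) = 0"
  obtains v where
    "\<And>r c. r \<le> k \<Longrightarrow> c < n \<Longrightarrow> (householder (band_vec m n v (Suc k)) * C) $$ (r, c) = 0"
proof -
  obtain u where u: "u \<in> carrier_vec m" "u \<bullet> u = 1" "u $ k \<le> 0"
    and supp: "\<And>l. l < m \<Longrightarrow> l < k \<or> k + n < l \<Longrightarrow> u $ l = 0"
    and orth: "\<And>c. c < n \<Longrightarrow> u \<bullet> col C c = 0"
    using ex_band_orthogonal_unit[OF C k] by metis
  \<comment> \<open>This is entry \<open>k\<close> of \<open>unit_vec m k - u\<close>; dividing by
    it gives the leading component 1.\<close>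
  define a where "a = 1 - u $ k"
  have a: "a > 0"
    using u(3) by (simp add: a_def)
  have km: "k < m"
    using k by simp
  \<comment> \<open>The shift \<open>j - 1\<close> passes from parameters counted from 1 to
    positions counted from 0.\<close>
  define v :: "nat \<Rightarrow> nat \<Rightarrow> real" where "v = (\<lambda>_ j. - u $ (j - 1) / a)"
  define w where "w = band_vec m n v (Suc k)"
  have w: "w \<in> carrier_vec m"
    by (simp add: w_def band_vec_def)
  have w_eq: "w = (1 / a) \<cdot>\<^sub>v (unit_vec m k - u)"
    using a u(1) km supp
    by (intro eq_vecI) (auto simp: w_def band_vec_def v_def unit_vec_def a_def field_simps)
  have e: "unit_vec m k \<in> carrier_vec m"
    by simp
  have wx: "w \<bullet> x = (x $ k - u \<bullet> x) / a" if x: "x \<in> carrier_vec m" for x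
    using u(1) x km by (simp add: w_eq minus_scalar_prod_distrib[OF e u(1) x])
  have wk: "w $ k = 1"
    using km by (simp add: w_def band_vec_def)
  have "u \<bullet> w = (u $ k - u \<bullet> u) / a"
    using u(1) km by (simp add: w_eq scalar_prod_minus_distrib[OF u(1) e u(1)])
  also have "u $ k - u \<bullet> u = - a"
    using u(2) by (simp add: a_def)
  finally have "u \<bullet> w = - 1"
    using a by simp
  then have ww: "w \<bullet> w = 2 / a"
    using wx[OF w] wk by simp
  show thesis
  proof (rule that[of v])
    fix r c assume r: "r \<le> k" and c: "c < n"
    have x: "col C c \<in> carrier_vec m"
      using C by auto
    have "(householder w * C) $$ (r, c) = col (householder w * C) c $ r"
      using householder_carrier[OF w] C r c k by simp
    also have "\<dots> = (householder w *\<^sub>v col C c) $ r"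
      using householder_carrier[OF w] C c by (simp add: col_mult2[of _ m m _ n])
    also have "\<dots> = C $$ (r, c) - (2 * (w \<bullet> col C c) / (w \<bullet> w)) * w $ r"
      using householder_mult_vec[OF w x] w C r c km by simp
    \<comment> \<open>Orthogonality of \<open>u\<close> to the column leaves
      \<open>w \<bullet> col C c = C $$ (k, c) / a\<close>, and \<open>w \<bullet> w = 2 / a\<close>
      cancels the rest.\<close>
    also have "2 * (w \<bullet> col C c) / (w \<bullet> w) = C $$ (k, c)"
      using a wx[OF x] orth[OF c] C km c by (simp add: ww)
    also have "C $$ (r, c) - C $$ (k, c) * w $ r = 0"
    proof (cases "r = k")
      case False
      then have "w $ r = 0"
        using r km by (simp add: w_def band_vec_def)
      then show ?thesis
        using zero[of r c] False r c by simp
    qed (simp add: wk)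
    finally show "(householder (band_vec m n v (Suc k)) * C) $$ (r, c) = 0"
      by (simp add: w_def)
  qed
qed

section \<open>Products of banded reflections\<close>

text \<open>By associativity the start value of the fold splits off as a right factor. This allows a
  reflection to be appended at the right end of the product.\<close>

lemma foldr_mat_mult:
  fixes F :: "'i \<Rightarrow> 'a :: semiring_1 mat"
  assumes F: "\<And>i. F i \<in> carrier_mat m m" and M: "M \<in> carrier_mat m p"
  shows "foldr (\<lambda>i M. F i * M) xs (1\<^sub>m m) \<in> carrier_mat m m"
    and "foldr (\<lambda>i M. F i * M) xs M = foldr (\<lambda>i M. F i * M) xs (1\<^sub>m m) * M"
proof (induction xs)
  case (Cons i xs)
  {
    case 1
    show ?case
      using mult_carrier_mat[OF F Cons.IH(1)] by simp
  next
    case 2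
    show ?case
      using assoc_mult_mat[OF F[of i] Cons.IH(1) M] Cons.IH(2) by simp
  }
qed (use M in auto)

lemma band_vec_carrier [simp]: "band_vec m n v i \<in> carrier_vec m"
  by (simp add: band_vec_def)

lemma band_vec_cong:
  assumes "\<And>j. i + 1 \<le> j \<Longrightarrow> j \<le> i + n \<Longrightarrow> v i j = w i j"
  shows "band_vec m n v i = band_vec m n w i"
  using assms by (auto simp: band_vec_def)

text \<open>Each factor reads only its own band parameters. Hence later parameters can be chosen
  without disturbing earlier factors, and \<open>band_params\<close> determines the whole
  product.\<close>

lemma foldr_householder_cong:
  assumes "\<And>i j. 1 \<le> i \<Longrightarrow> i \<le> k \<Longrightarrow> i + 1 \<le> j \<Longrightarrow> j \<le> i + n \<Longrightarrow> v i j = w i j"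
  shows "foldr (\<lambda>i M. householder (band_vec m n v i) * M) [1..<Suc k] M =
    foldr (\<lambda>i M. householder (band_vec m n w i) * M) [1..<Suc k] M"
proof (intro foldr_cong refl)
  fix i M assume "i \<in> set [1..<Suc k]"
  then show "householder (band_vec m n v i) * M = householder (band_vec m n w i) * M"
    using assms band_vec_cong[of i n v w m] by auto
qed

text \<open>Induction on the number \<open>k\<close> of annihilated rows, with \<open>C\<close> as
  the remaining matrix. The bound on \<open>k\<close> keeps every band inside the \<open>m\<close>
  positions.\<close>

lemma ex_banded_elimination:
  assumes A: "A \<in> carrier_mat m n" and "k + n \<le> m"
  shows "\<exists>v C. C \<in> carrier_mat m n \<and> (\<forall>r<k. \<forall>c<n. C $$ (r, c) = 0) \<and>
    A = foldr (\<lambda>i M. householder (band_vec m n v i) * M) [1..<Suc k] (1\<^sub>m m) * C"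
  using assms(2)
proof (induction k)
  case 0
  then show ?case
    using A by (intro exI[of _ undefined] exI[of _ A]) auto
next
  case (Suc k)
  obtain v C where C: "C \<in> carrier_mat m n" and zero: "\<forall>r<k. \<forall>c<n. C $$ (r, c) = 0"
    and A_eq: "A = foldr (\<lambda>i M. householder (band_vec m n v i) * M) [1..<Suc k] (1\<^sub>m m) * C"
    using Suc by auto
  obtain v' where v': "\<And>r c. r \<le> k \<Longrightarrow> c < n \<Longrightarrow>
      (householder (band_vec m n v' (Suc k)) * C) $$ (r, c) = 0"
    using ex_band_householder_step[OF C, of k] zero Suc.prems by auto
  \<comment> \<open>The earlier parameters are kept and those of reflection \<open>Suc k\<close>
    come from the new step.\<close>
  define w where "w = v(Suc k := v' (Suc k))"
  let ?G = "\<lambda>v. foldr (\<lambda>i M. householder (band_vec m n v i) * M)"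
  define H where "H = householder (band_vec m n w (Suc k))"
  have H: "H \<in> carrier_mat m m"
    by (simp add: H_def)
  have "band_vec m n w (Suc k) = band_vec m n v' (Suc k)"
    by (rule band_vec_cong) (simp add: w_def)
  then have HC: "(H * C) $$ (r, c) = 0" if "r < Suc k" "c < n" for r c
    using v' that by (simp add: H_def)
  have G: "?G w [1..<Suc k] (1\<^sub>m m) = ?G v [1..<Suc k] (1\<^sub>m m)"
    by (rule foldr_householder_cong) (simp add: w_def)
  have G_carrier: "?G w [1..<Suc k] (1\<^sub>m m) \<in> carrier_mat m m"
    by (rule foldr_mat_mult(1)[OF _ one_carrier_mat]) simp
  have "?G w [1..<Suc (Suc k)] (1\<^sub>m m) = ?G w [1..<Suc k] (H * 1\<^sub>m m)"
    by (simp add: H_def)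
  also have "H * 1\<^sub>m m = H"
    by (rule right_mult_one_mat[OF H])
  also have "?G w [1..<Suc k] H = ?G w [1..<Suc k] (1\<^sub>m m) * H"
    by (rule foldr_mat_mult(2)[OF _ H]) simp
  finally have "?G w [1..<Suc (Suc k)] (1\<^sub>m m) * (H * C) = ?G w [1..<Suc k] (1\<^sub>m m) * (H * (H * C))"
    using assoc_mult_mat[OF G_carrier H mult_carrier_mat[OF H C]] by simp
  \<comment> \<open>The new reflection is inserted twice: one copy joins the product, the other
    clears row \<open>k\<close> of \<open>C\<close>.\<close>
  also have "H * (H * C) = C"
    unfolding H_def by (rule householder_involution_mat[OF band_vec_carrier C])
  finally have "A = ?G w [1..<Suc (Suc k)] (1\<^sub>m m) * (H * C)"
    using A_eq G by simp
  then show ?case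
    using HC H C by (intro exI[of _ w] exI[of _ "H * C"]) auto
qed

lemma card_band_params: "card (band_params m n) = n * (m - n)"
proof -
  have "band_params m n = (SIGMA i:{1..m - n}. {i + 1..i + n})"
    by (auto simp: band_params_def)
  then show ?thesis
    by simp
qed

theorem theorem2:
  fixes m n :: nat and A :: "real mat"
  assumes "0 < n" and "n \<le> m" and "A \<in> carrier_mat m n"
  shows "(\<exists>(v :: nat \<Rightarrow> nat \<Rightarrow> real) (B :: real mat).
            B \<in> carrier_mat n n \<and>
            A = banded_householder m n v * (0\<^sub>m (m - n) n @\<^sub>r B)) \<and>
         (\<forall>v w :: nat \<Rightarrow> nat \<Rightarrow> real.
            (\<forall>(i, j) \<in> band_params m n. v i j = w i j) \<longrightarrow>
            banded_householder m n v = banded_householder m n w) \<and>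
         card (band_params m n) = n * (m - n)"
proof (intro conjI allI impI)
  obtain v C where C: "C \<in> carrier_mat m n" and zero: "\<forall>r<m - n. \<forall>c<n. C $$ (r, c) = 0"
    and A: "A = banded_householder m n v * C"
    using ex_banded_elimination[OF assms(3), of "m - n"] assms(2)
    by (auto simp: banded_householder_def)
  \<comment> \<open>After \<open>m - n\<close> eliminations only the last \<open>n\<close> rows of
    \<open>C\<close> can be nonzero; they form the block.\<close>
  define B where "B = mat n n (\<lambda>(r, c). C $$ (m - n + r, c))"
  have "C = 0\<^sub>m (m - n) n @\<^sub>r B"
    using C zero assms(2) by (intro eq_matI) (auto simp: append_rows_def B_def)
  then show "\<exists>v B. B \<in> carrier_mat n n \<and> A = banded_householder m n v * (0\<^sub>m (m - n) n @\<^sub>r B)"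
    using A by (intro exI[of _ v] exI[of _ B]) (simp add: B_def)
next
  fix v w :: "nat \<Rightarrow> nat \<Rightarrow> real"
  assume "\<forall>(i, j) \<in> band_params m n. v i j = w i j"
  then show "banded_householder m n v = banded_householder m n w"
    unfolding banded_householder_def
    by (intro foldr_householder_cong) (auto simp: band_params_def)
qed (rule card_band_params)

end
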